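(* Let $n$ and $l$ be positive integers. The height of an $l$-generated associative $\mathrm{PI}$-algebra over a field satisfying an admissible polynomial identity of degree $n$, over the set of words (in the generators) of length less than $n$, does not exceed $$\Phi(n,l) = E_1\, l\cdot n^{E_2+12\log_3 n},$$ where $E_1 = 4^{21\log_3 4 + 17}$ and $E_2 = 30\log_3 4 + 10$.
   Context: An admissible polynomial identity is a polynomial identity (in noncommuting variables) having coefficient $1$ at some term of the highest degree. An algebra $A$ has height $h$ over a set of words $Y=\{u_1,u_2,\ldots\}$ (words in the generators of $A$) if $h$ is the minimal integer such that every word $x$ from $A$ can be represented in the form $$x=\sum_i\alpha_i\,u_{j_{(i,1)}}^{k_{(i,1)}}u_{j_{(i,2)}}^{k_{(i,2)}}\cdots u_{j_{(i,r_i)}}^{k_{(i,r_i)}}$$ with scalars $\alpha_i$ and all $r_i\leqslant h$. *)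

theory Defs
  imports Complex_Main "HOL-Library.Poly_Mapping"
begin

text \<open>
  Algebras are not assumed to have a unit (class \<^class>\<open>ring\<close>); accordingly, words are
  nonempty lists of letters and polynomials have no constant term.
\<close>

locale assoc_algebra = vector_space scale
  for scale :: "'k::field \<Rightarrow> 'a::ring \<Rightarrow> 'a" +
  assumes scale_mult_left: "scale c x * y = scale c (x * y)"
    and scale_mult_right: "x * scale c y = scale c (x * y)"

definition subalgebra :: "('k::field \<Rightarrow> 'a::ring \<Rightarrow> 'a) \<Rightarrow> 'a set \<Rightarrow> bool" where
  "subalgebra scale S \<longleftrightarrow>
     module.subspace scale S \<and> (\<forall>x\<in>S. \<forall>y\<in>S. x * y \<in> S)"

text \<open>The generators \<open>a 0, \<dots>, a (l - 1)\<close> need not be distinct.\<close>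

definition generated_by :: "('k::field \<Rightarrow> 'a::ring \<Rightarrow> 'a) \<Rightarrow> nat \<Rightarrow> (nat \<Rightarrow> 'a) \<Rightarrow> bool" where
  "generated_by scale l a \<longleftrightarrow> subalgebra scale hull (a ` {..<l}) = UNIV"

text \<open>The value at the empty list is a dummy; it is not used on words.\<close>

fun word_val :: "(nat \<Rightarrow> 'a::ring) \<Rightarrow> nat list \<Rightarrow> 'a" where
  "word_val s [] = 0"
| "word_val s [x] = s x"
| "word_val s (x # y # w) = s x * word_val s (y # w)"

text \<open>
  A polynomial in the noncommuting variables \<open>0, 1, 2, \<dots>\<close> is a finitely supported
  coefficient function on monomials, a monomial being a list of variables.
\<close>

type_synonym 'k ncpoly = "nat list \<Rightarrow>\<^sub>0 'k"

definition ncdegree :: "'k::zero ncpoly \<Rightarrow> nat" where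
  "ncdegree f = Max (insert 0 (length ` Poly_Mapping.keys f))"

definition admissible :: "'k::field ncpoly \<Rightarrow> bool" where
  "admissible f \<longleftrightarrow>
     [] \<notin> Poly_Mapping.keys f \<and>
     (\<exists>w. length w = ncdegree f \<and> Poly_Mapping.lookup f w = 1)"

definition satisfies_identity :: "('k::field \<Rightarrow> 'a::ring \<Rightarrow> 'a) \<Rightarrow> 'k ncpoly \<Rightarrow> bool" where
  "satisfies_identity scale f \<longleftrightarrow>
     (\<forall>s :: nat \<Rightarrow> 'a.
        (\<Sum>w\<in>Poly_Mapping.keys f. scale (Poly_Mapping.lookup f w) (word_val s w)) = 0)"

definition words :: "nat \<Rightarrow> nat list set" where
  "words l = {w. w \<noteq> [] \<and> set w \<subseteq> {..<l}}"

text \<open>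
  The list \<open>[(u\<^sub>1, k\<^sub>1), \<dots>, (u\<^sub>r, k\<^sub>r)]\<close> encodes the word
  \<open>u\<^sub>1\<^sup>k\<^sup>1 \<cdots> u\<^sub>r\<^sup>k\<^sup>r\<close>.  For lack of a unit the exponents and \<open>r\<close> are positive; exponent
  zero would only amount to omitting a factor.
\<close>

definition power_product :: "(nat list \<times> nat) list \<Rightarrow> nat list" where
  "power_product B = concat (map (\<lambda>(u, k). concat (replicate k u)) B)"

definition power_products :: "nat list set \<Rightarrow> nat \<Rightarrow> (nat list \<times> nat) list set" where
  "power_products Y h =
     {B. B \<noteq> [] \<and> length B \<le> h \<and> (\<forall>(u, k)\<in>set B. u \<in> Y \<and> 0 < k)}"

definition height_bound ::
    "('k::field \<Rightarrow> 'a::ring \<Rightarrow> 'a) \<Rightarrow> nat \<Rightarrow> (nat \<Rightarrow> 'a) \<Rightarrow> nat list set \<Rightarrow> nat \<Rightarrow> bool" where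
  "height_bound scale l a Y h \<longleftrightarrow>
     (\<forall>x\<in>words l. \<exists>(m::nat) (\<alpha> :: nat \<Rightarrow> 'k) B.
        (\<forall>i<m. B i \<in> power_products Y h) \<and>
        word_val a x = (\<Sum>i<m. scale (\<alpha> i) (word_val a (power_product (B i)))))"

definition has_height ::
    "('k::field \<Rightarrow> 'a::ring \<Rightarrow> 'a) \<Rightarrow> nat \<Rightarrow> (nat \<Rightarrow> 'a) \<Rightarrow> nat list set \<Rightarrow> nat \<Rightarrow> bool" where
  "has_height scale l a Y h \<longleftrightarrow>
     height_bound scale l a Y h \<and> (\<forall>h'. height_bound scale l a Y h' \<longrightarrow> h \<le> h')"

definition E1 :: real where
  "E1 = 4 powr (21 * log 3 4 + 17)"

definition E2 :: real where
  "E2 = 30 * log 3 4 + 10"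

definition Phi :: "nat \<Rightarrow> nat \<Rightarrow> real" where
  "Phi n l = E1 * real l * real n powr (E2 + 12 * log 3 (real n))"

end

theory Submission
  imports Defs "HOL-Library.List_Lexorder"
begin

text \<open>
  The algebraic half is Shirshov's.  Multilinearising an admissible identity of degree \<open>n\<close> writes
  every product \<open>x\<^sub>1 \<cdots> x\<^sub>n\<close> as a combination of the same factors in other orders.  If a word contains
  consecutive blocks \<open>w\<^sub>1 \<succ> \<dots> \<succ> w\<^sub>n\<close>, each comparison being decided at a position common to both
  blocks, then every other order of the blocks gives a lexicographically smaller word of the same
  length.  By well-founded induction, the words without such blocks span the algebra
  (\<open>word_val_in_span_nondivisible\<close>), and it remains to write one such word \<open>w\<close> as a product of few
  powers of words shorter than \<open>n\<close>.

  Fix a power of two \<open>P\<close> with \<open>n \<le> P < 2 n\<close>, and compare positions of \<open>w\<close> by the factors of length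
  \<open>P\<close> that begin there.  A sequence of \<open>n\<close> positions, successive ones at distance at least \<open>P\<close>, along
  which these factors strictly decrease would exhibit \<open>n\<close> decreasing blocks.  Hence, as in Mirsky's
  dual of Dilworth's theorem, fewer than \<open>n\<close> colours suffice so that, within one colour, the factor
  of length \<open>P\<close> weakly increases between positions at distance at least \<open>P\<close>
  (\<open>nondivisible_colouring\<close>).

  Call a segment of positions \<open>q\<close>-uniform if the colour of a position determines the factor of
  length \<open>q\<close> at it.  Inside such a segment a factor of length \<open>2 q\<close> is determined by two colours, those
  of its two halves, so the pair of colour and \<open>2 q\<close>-factor takes fewer than \<open>n\<^sup>2\<close> values.  As the
  \<open>2 q\<close>-factors of one colour almost increase, deleting one window of length \<open>P\<close> per value leaves
  segments that are \<open>2 q\<close>-uniform (\<open>segment_bound_refine\<close>).  So each doubling of \<open>q\<close> costs a factor of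
  about \<open>n\<^sup>2\<close>; starting with single letters, \<open>log\<^sub>2 P\<close> doublings give \<open>P\<close>-uniform segments.  Such a
  segment has fewer than \<open>n \<le> P\<close> distinct factors of length \<open>P\<close>, and by the argument of Morse and
  Hedlund it becomes periodic, with period below \<open>n\<close>, after fewer than \<open>n\<close> letters
  (\<open>few_factors_segment_bound\<close>).  Altogether about \<open>l n powr (5 + 2 log\<^sub>2 n)\<close> powers suffice, and
  \<open>2 log\<^sub>2 n \<le> 4 log\<^sub>3 n\<close>, well below the exponent of the theorem.
\<close>

section \<open>Lexicographic comparison and divisible words\<close>

text \<open>
  A word and its proper prefixes are incomparable: a comparison has to survive arbitrary
  continuations of both words.
\<close>

definition lex_below :: "nat list \<Rightarrow> nat list \<Rightarrow> bool"  (infix \<open>\<prec>\<close> 50) where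
  "u \<prec> v \<longleftrightarrow> (\<exists>p a b u' v'. a < b \<and> u = p @ a # u' \<and> v = p @ b # v')"

definition divisible :: "nat \<Rightarrow> nat list \<Rightarrow> bool" where
  "divisible n w \<longleftrightarrow>
     (\<exists>x ws y. w = x @ concat ws @ y \<and> length ws = n \<and> [] \<notin> set ws \<and>
        sorted_wrt (\<lambda>u v. v \<prec> u) ws)"

lemma divisible_0: "divisible 0 w"
  unfolding divisible_def by (intro exI[of _ "[]"] exI[of _ w]) simp

lemma lex_below_imp_less: "u \<prec> v \<Longrightarrow> u < v"
  unfolding lex_below_def list_less_def lexord_def by blast

lemma lex_below_iff_less: "length u = length v \<Longrightarrow> u \<prec> v \<longleftrightarrow> u < v"
  unfolding lex_below_def list_less_def lexord_def by auto blast+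

lemma lex_below_takeD: "take q u \<prec> take q v \<Longrightarrow> u \<prec> v"
  unfolding lex_below_def by (metis append.assoc append_Cons append_take_drop_id)

lemma take_mono:
  fixes u v :: "nat list"
  assumes "length u = length v" "u \<le> v"
  shows "take q u \<le> take q v"
proof (rule ccontr)
  assume "\<not> take q u \<le> take q v"
  then have "take q v \<prec> take q u"
    using assms(1) by (simp add: lex_below_iff_less)
  then have "v < u"
    using lex_below_takeD lex_below_imp_less by blast
  then show False using assms(2) by simp
qed

section \<open>Colouring the positions of a word\<close>

definition factor :: "nat list \<Rightarrow> nat \<Rightarrow> nat \<Rightarrow> nat list" where
  "factor w i q = take q (drop i w)"

lemma length_factor: "i + q \<le> length w \<Longrightarrow> length (factor w i q) = q"
  by (simp add: factor_def)

lemma factor_add: "factor w i (p + q) = factor w i p @ factor w (i + p) q"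
  by (simp add: factor_def take_add add.commute)

lemma factor_mono:
  assumes "i + P \<le> length w" "j + P \<le> length w" "factor w i P \<le> factor w j P" "q \<le> P"
  shows "factor w i q \<le> factor w j q"
  using take_mono[of "factor w i P" "factor w j P" q] assms
  by (simp add: factor_def min_absorb1 le_diff_conv2)

text \<open>
  A descent of \<open>k\<close> steps is a sequence of \<open>k + 1\<close> positions.  Consecutive positions are at least \<open>P\<close>
  apart, so that the factors compared by a descent are prefixes of the blocks between its positions.
\<close>

primrec descent :: "nat list \<Rightarrow> nat \<Rightarrow> nat \<Rightarrow> nat \<Rightarrow> bool" where
  "descent w P 0 i \<longleftrightarrow> i + P \<le> length w"
| "descent w P (Suc k) i \<longleftrightarrow>
     (\<exists>j. i + P \<le> j \<and> factor w j P < factor w i P \<and> descent w P k j)"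

lemma descent_in_range: "descent w P k i \<Longrightarrow> i + P \<le> length w"
  by (induction k arbitrary: i) (auto, fastforce)

text \<open>
  Cutting the word at the positions of a descent gives the blocks; the last block is the factor of
  length \<open>P\<close> at the last position.
\<close>

lemma descent_blocks:
  assumes "descent w P k i"
  shows "\<exists>u us y. drop i w = concat (u # us) @ y \<and> length us = k \<and> (\<forall>v\<in>set (u # us). P \<le> length v) \<and>
           take P u = factor w i P \<and> sorted_wrt (\<lambda>u v. take P v < take P u) (u # us)"
  using assms
proof (induction k arbitrary: i)
  case 0
  then show ?case
    by (intro exI[of _ "factor w i P"] exI[of _ "[]"] exI[of _ "drop (i + P) w"])
      (auto simp: factor_def add.commute simp flip: drop_drop)
next
  case (Suc k)
  then obtain j where j: "i + P \<le> j" "factor w j P < factor w i P" "descent w P k j"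
    by auto
  obtain u us y where u: "drop j w = concat (u # us) @ y" "length us = k"
      "\<forall>v\<in>set (u # us). P \<le> length v" "take P u = factor w j P"
      "sorted_wrt (\<lambda>u v. take P v < take P u) (u # us)"
    using Suc.IH[OF j(3)] by blast
  have "drop i w = factor w i (j - i) @ drop j w"
    using j(1) unfolding factor_def by (metis append_take_drop_id drop_drop le_add_diff_inverse2 add_leD1)
  moreover have "take P (factor w i (j - i)) = factor w i P"
    using j(1) by (simp add: factor_def min_def)
  moreover have "length (factor w i (j - i)) = j - i"
    using descent_in_range[OF j(3)] by (simp add: factor_def)
  moreover have "take P v < factor w i P" if "v \<in> set (u # us)" for v
    using that u(4,5) j(2) by auto
  ultimately show ?case
    using u j(1)
    by (intro exI[of _ "factor w i (j - i)"] exI[of _ "u # us"] exI[of _ y]) auto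
qed

lemma descent_imp_divisible:
  assumes "descent w P k i" "0 < P"
  shows "divisible (Suc k) w"
proof -
  obtain u us y where u: "drop i w = concat (u # us) @ y" "length us = k"
      "\<forall>v\<in>set (u # us). P \<le> length v"
      "sorted_wrt (\<lambda>u v. take P v < take P u) (u # us)"
    using descent_blocks[OF assms(1)] by blast
  have "v \<prec> x"
    if "x \<in> set (u # us)" "v \<in> set (u # us)" "take P v < take P x" for x v
  proof -
    have "P \<le> length x" "P \<le> length v"
      using that u(3) by blast+
    then have "take P v \<prec> take P x"
      using that(3) by (simp add: lex_below_iff_less)
    then show ?thesis by (rule lex_below_takeD)
  qed
  then have "sorted_wrt (\<lambda>u v. v \<prec> u) (u # us)"
    by (rule sorted_wrt_mono_rel[OF _ u(4)])
  moreover have "w = take i w @ concat (u # us) @ y"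
    by (simp only: u(1)[symmetric] append_take_drop_id)
  moreover have "[] \<notin> set (u # us)"
    using u(3) assms(2) by (metis leD list.size(3))
  ultimately show ?thesis
    unfolding divisible_def using u(2)
    by (intro exI[of _ "take i w"] exI[of _ "u # us"] exI[of _ y]) simp
qed

text \<open>
  The colour of a position is the length of the longest descent that starts there: a step of a
  descent strictly lowers it, so no step joins two positions of the same colour.
\<close>

lemma nondivisible_colouring:
  assumes "\<not> divisible n w" "0 < P"
  obtains r :: "nat \<Rightarrow> nat" where
    "\<And>i. i + P \<le> length w \<Longrightarrow> r i < n - 1"
    "\<And>i j. i + P \<le> j \<Longrightarrow> j + P \<le> length w \<Longrightarrow> r i = r j \<Longrightarrow> factor w i P \<le> factor w j P"
proof -
  define S where "S i = {k. k < n - 1 \<and> descent w P k i}" for i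
  define r where "r i = Max (S i)" for i
  have "n \<noteq> 0"
    using assms(1) divisible_0 by metis
  have no: "\<not> descent w P (n - 1) i" for i
    using descent_imp_divisible[OF _ assms(2), of w "n - 1" i] assms(1) \<open>n \<noteq> 0\<close> by auto
  have fin: "finite (S i)" for i
    by (simp add: S_def)
  have in_S: "r i \<in> S i" if "i + P \<le> length w" for i
  proof -
    have "descent w P 0 i" using that by simp
    then have "n - 1 \<noteq> 0" using no by metis
    then have "0 \<in> S i" using \<open>descent w P 0 i\<close> by (simp add: S_def)
    then show ?thesis unfolding r_def using fin by (intro Max_in) auto
  qed
  show ?thesis
  proof
    show "r i < n - 1" if "i + P \<le> length w" for i
      using in_S[OF that] by (simp add: S_def)
    show "factor w i P \<le> factor w j P"
      if "i + P \<le> j" "j + P \<le> length w" "r i = r j" for i j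
    proof (rule ccontr)
      assume "\<not> factor w i P \<le> factor w j P"
      then have less: "factor w j P < factor w i P" by simp
      have rj: "descent w P (r j) j" "r j < n - 1"
        using in_S[OF that(2)] by (simp_all add: S_def)
      have "descent w P (Suc (r j)) i"
        unfolding descent.simps using that(1) less rj(1) by blast
      moreover from this have "Suc (r j) \<noteq> n - 1"
        using no[of i] by metis
      ultimately have "Suc (r j) \<in> S i" using rj(2) by (simp add: S_def del: descent.simps)
      then have "Suc (r j) \<le> r i" unfolding r_def[of i] using fin by (intro Max_ge)
      then show False using that(3) by simp
    qed
  qed
qed

section \<open>Products of powers of short words\<close>

definition short_powers :: "nat \<Rightarrow> nat \<Rightarrow> nat list \<Rightarrow> bool" where
  "short_powers n h w \<longleftrightarrow>
     (\<exists>B. power_product B = w \<and> length B \<le> h \<and> (\<forall>(u, k)\<in>set B. u \<noteq> [] \<and> length u < n \<and> 0 < k))"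

lemma short_powers_mono: "short_powers n h w \<Longrightarrow> h \<le> h' \<Longrightarrow> short_powers n h' w"
  unfolding short_powers_def using le_trans by blast

lemma short_powers_append:
  assumes "short_powers n g u" "short_powers n h v"
  shows "short_powers n (g + h) (u @ v)"
proof -
  obtain B C where
    "power_product B = u \<and> length B \<le> g \<and> (\<forall>(u, k)\<in>set B. u \<noteq> [] \<and> length u < n \<and> 0 < k)"
    "power_product C = v \<and> length C \<le> h \<and> (\<forall>(u, k)\<in>set C. u \<noteq> [] \<and> length u < n \<and> 0 < k)"
    using assms unfolding short_powers_def by blast
  then show ?thesis
    unfolding short_powers_def by (intro exI[of _ "B @ C"]) (auto simp: power_product_def)
qed

lemma short_powers_length:
  assumes "2 \<le> n"
  shows "short_powers n (length w) w"
proof -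
  have "power_product (map (\<lambda>x. ([x], 1)) w) = w"
    by (induction w) (auto simp: power_product_def)
  then show ?thesis
    unfolding short_powers_def using assms by (intro exI[of _ "map (\<lambda>x. ([x], 1)) w"]) auto
qed

lemma short_powers_power:
  assumes "length u < n"
  shows "short_powers n 1 (concat (replicate k u))"
proof (cases "k = 0 \<or> u = []")
  case True
  then have "concat (replicate k u) = []" by auto
  then show ?thesis unfolding short_powers_def by (intro exI[of _ "[]"]) (auto simp: power_product_def)
next
  case False
  then show ?thesis unfolding short_powers_def using assms
    by (intro exI[of _ "[(u, k)]"]) (auto simp: power_product_def)
qed

lemma periodic_eq_power:
  assumes "length u = t" "0 < t" "\<And>j. j < length v \<Longrightarrow> v ! j = u ! (j mod t)"
  shows "\<exists>k x. v = concat (replicate k u) @ x \<and> length x < t"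
  using assms(3)
proof (induction "length v" arbitrary: v rule: less_induct)
  case less
  show ?case
  proof (cases "length v < t")
    case True
    then show ?thesis by (intro exI[of _ 0] exI[of _ v]) auto
  next
    case False
    have "take t v = u"
      using False assms(1) less.prems by (intro nth_equalityI) auto
    moreover have "\<exists>k x. drop t v = concat (replicate k u) @ x \<and> length x < t"
    proof (rule less.hyps)
      show "length (drop t v) < length v" using False assms(2) by simp
      show "drop t v ! j = u ! (j mod t)" if "j < length (drop t v)" for j
        using that less.prems[of "t + j"] by simp
    qed
    ultimately obtain k x where "v = u @ concat (replicate k u) @ x" "length x < t"
      by (metis append_take_drop_id)
    then show ?thesis by (intro exI[of _ "Suc k"] exI[of _ x]) auto
  qed
qed

lemma periodic_short_powers:
  assumes "0 < t" "t < n" "\<And>j. j + t < length v \<Longrightarrow> v ! j = v ! (j + t)"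
  shows "short_powers n 2 v"
proof (cases "length v < t")
  case True
  then show ?thesis
    using short_powers_power[of v n 1] assms(2) short_powers_mono[of n 1 v 2] by simp
next
  case False
  have "v ! j = take t v ! (j mod t)" if "j < length v" for j
    using that
  proof (induction j rule: less_induct)
    case (less j)
    show ?case
    proof (cases "j < t")
      case False
      then have "j - t + t = j" by simp
      then have "v ! j = v ! (j - t)"
        using assms(3)[of "j - t"] less.prems by metis
      also have "\<dots> = take t v ! ((j - t) mod t)"
        using False less.prems assms(1) by (intro less.IH) auto
      finally show ?thesis
        using False by (simp add: le_mod_geq)
    qed simp
  qed
  then obtain k x where v: "v = concat (replicate k (take t v)) @ x" "length x < t"
    using periodic_eq_power[of "take t v" t v] False assms(1) by auto
  have "short_powers n 1 (concat (replicate k (take t v)))"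
    using assms(2) False by (intro short_powers_power) simp
  moreover have "short_powers n 1 x"
    using short_powers_power[of x n 1] v(2) assms(2) by simp
  ultimately have "short_powers n (1 + 1) v"
    using short_powers_append v(1) by metis
  then show ?thesis by (simp add: numeral_2_eq_2)
qed

text \<open>
  Segments are given by their end points, because lengths, windows and colours all refer to
  positions in the whole word.
\<close>

definition segment_bound :: "nat \<Rightarrow> nat list \<Rightarrow> nat \<Rightarrow> nat \<Rightarrow> nat \<Rightarrow> bool" where
  "segment_bound n w h a b \<longleftrightarrow> short_powers n h (factor w a (b - a))"

lemma segment_bound_mono: "segment_bound n w h a b \<Longrightarrow> h \<le> h' \<Longrightarrow> segment_bound n w h' a b"
  unfolding segment_bound_def by (rule short_powers_mono)

lemma segment_bound_join:
  assumes "segment_bound n w g a b" "segment_bound n w h b c" "a \<le> b" "b \<le> c"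
  shows "segment_bound n w (g + h) a c"
proof -
  have "c - a = (b - a) + (c - b)" using assms by simp
  then have "factor w a (c - a) = factor w a (b - a) @ factor w b (c - b)"
    using assms(3) by (simp only: factor_add) simp
  then show ?thesis
    using assms short_powers_append unfolding segment_bound_def by metis
qed

lemma segment_bound_length: "2 \<le> n \<Longrightarrow> segment_bound n w (b - a) a b"
  unfolding segment_bound_def
  by (rule short_powers_mono[OF short_powers_length]) (auto simp: factor_def)

text \<open>
  Deleting the windows leaves at most one more segment than there are windows, and the letters of a
  window cost one power each.  The induction removes the rightmost window first: whatever lies to
  the right of it avoids all the others too.
\<close>

lemma segment_bound_windows:
  assumes "finite X" "2 \<le> n" "a \<le> b"
    "\<And>c d. a \<le> c \<Longrightarrow> c \<le> d \<Longrightarrow> d \<le> b \<Longrightarrow> (\<forall>x\<in>X. \<forall>i\<in>{c..<d}. i \<notin> {x..<x + P}) \<Longrightarrow>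
       segment_bound n w h c d"
  shows "segment_bound n w (card X * P + (card X + 1) * h) a b"
  using assms
proof (induction X arbitrary: b rule: finite_linorder_max_induct)
  case empty
  then show ?case by simp
next
  case (insert x X)
  \<comment> \<open>the window starting at \<open>x\<close>, clipped to the segment\<close>
  define c where "c = max a (min b x)"
  define d where "d = max a (min b (x + P))"
  have "segment_bound n w (card X * P + (card X + 1) * h) a c"
  proof (rule insert.IH)
    show "a \<le> c" by (simp add: c_def)
    show "segment_bound n w h c' d'"
      if "a \<le> c'" "c' \<le> d'" "d' \<le> c" "\<forall>x\<in>X. \<forall>i\<in>{c'..<d'}. i \<notin> {x..<x + P}" for c' d'
      using that insert.prems(2) by (intro insert.prems(3)) (auto simp: c_def)
  qed (use insert.prems in auto)
  moreover have "segment_bound n w P c d"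
    by (rule segment_bound_mono[OF segment_bound_length]) (use insert.prems in \<open>auto simp: c_def d_def\<close>)
  moreover have "segment_bound n w h d b"
    using insert.prems(2) insert.hyps(2)
    by (intro insert.prems(3)) (fastforce simp: d_def)+
  ultimately have "segment_bound n w (card X * P + (card X + 1) * h + P + h) a b"
    using insert.prems(2) by (intro segment_bound_join[of n w _ a d _ b] segment_bound_join[of n w _ a c _ d])
      (auto simp: c_def d_def)
  moreover have "card (insert x X) = card X + 1"
    using insert.hyps by auto
  ultimately show ?case by (simp add: algebra_simps)
qed

section \<open>Segments with few distinct factors\<close>

text \<open>
  The number of distinct factors of length \<open>q\<close> equals \<open>1\<close> for \<open>q = 0\<close> and cannot rise at each of \<open>P\<close>
  steps without exceeding \<open>P\<close>.  Where it does not rise, no factor of length \<open>q\<close> has two extensions.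
\<close>

lemma few_factors_determine_next:
  assumes "card ((\<lambda>i. factor w i P) ` {a..<b}) \<le> P" "a < b"
  obtains q where "q < P"
    "\<And>i j. i \<in> {a..<b} \<Longrightarrow> j \<in> {a..<b} \<Longrightarrow> factor w i q = factor w j q \<Longrightarrow>
       factor w i (Suc q) = factor w j (Suc q)"
proof -
  define f where "f q = (\<lambda>i. factor w i q) ` {a..<b}" for q
  have f_Suc: "f q = take q ` f (Suc q)" for q
    by (force simp: f_def factor_def image_image)
  have "\<exists>q<P. card (f (Suc q)) \<le> card (f q)"
  proof (rule ccontr)
    assume "\<not> ?thesis"
    then have step: "card (f q) < card (f (Suc q))" if "q < P" for q
      using that by force
    have "q < card (f q)" if "q \<le> P" for q
      using that
    proof (induction q)
      case 0
      have "f 0 = {[]}" using assms(2) by (auto simp: f_def factor_def)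
      then show ?case by simp
    next
      case (Suc q)
      then show ?case using step[of q] by simp
    qed
    then show False using assms(1) by (force simp: f_def)
  qed
  then obtain q where q: "q < P" "card (f (Suc q)) \<le> card (take q ` f (Suc q))"
    using f_Suc by metis
  have fin: "finite (f (Suc q))" by (simp add: f_def)
  then have inj: "inj_on (take q) (f (Suc q))"
    using q(2) card_image_le by (intro eq_card_imp_inj_on) (auto intro!: antisym)
  show ?thesis
  proof (rule that[OF q(1)])
    fix i j assume ij: "i \<in> {a..<b}" "j \<in> {a..<b}" "factor w i q = factor w j q"
    then have "take q (factor w i (Suc q)) = take q (factor w j (Suc q))"
      by (simp add: factor_def)
    then show "factor w i (Suc q) = factor w j (Suc q)"
      using inj ij by (auto simp: f_def dest!: inj_onD)
  qed
qed

text \<open>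
  Two of the first \<open>N + 1\<close> positions carry the same factor of length \<open>q\<close>; as each such factor
  determines its successor, the segment is periodic from the first of the two positions on.
\<close>

lemma few_factors_segment_bound:
  assumes "card ((\<lambda>i. factor w i P) ` {a..<b}) \<le> N" "N < n" "N \<le> P" "2 \<le> n"
    and range: "\<And>i. i < b \<Longrightarrow> i + P \<le> length w"
  shows "segment_bound n w (n + 1) a b"
proof (cases "b - a \<le> n + 1")
  case True
  then show ?thesis using segment_bound_mono[OF segment_bound_length] assms by blast
next
  case False
  then have "a < b" by simp
  moreover have "card ((\<lambda>i. factor w i P) ` {a..<b}) \<le> P"
    using assms(1,3) by (rule le_trans)
  ultimately obtain q where q: "q < P"
    "\<And>i j. i \<in> {a..<b} \<Longrightarrow> j \<in> {a..<b} \<Longrightarrow> factor w i q = factor w j q \<Longrightarrow>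
       factor w i (Suc q) = factor w j (Suc q)"
    using few_factors_determine_next[of w P a b] \<open>a < b\<close> by metis
  have "(\<lambda>i. factor w i q) ` {a..<b} = take q ` (\<lambda>i. factor w i P) ` {a..<b}"
    using q(1) by (force simp: factor_def image_image min_def)
  then have "card ((\<lambda>i. factor w i q) ` {a..<b}) \<le> N"
    using assms(1) card_image_le[of "(\<lambda>i. factor w i P) ` {a..<b}" "take q"] by simp
  moreover have "card ((\<lambda>i. factor w i q) ` {a..a + N}) \<le> card ((\<lambda>i. factor w i q) ` {a..<b})"
    using False assms(2) by (intro card_mono image_mono) auto
  ultimately have "\<not> inj_on (\<lambda>i. factor w i q) {a..a + N}"
    by (intro pigeonhole) simp
  then obtain i j where ij: "a \<le> i" "i < j" "j \<le> a + N" "factor w i q = factor w j q"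
    unfolding inj_on_def by (metis atLeastAtMost_iff linorder_neqE_nat)
  define t where "t = j - i"
  have t: "0 < t" "t \<le> N" using ij by (auto simp: t_def)
  have per: "factor w k q = factor w (k + t) q" if "i \<le> k" "k + t < b" for k
    using that
  proof (induction k rule: dec_induct)
    case base
    then show ?case using ij by (simp add: t_def)
  next
    case (step k)
    then have "factor w k (1 + q) = factor w (k + t) (1 + q)"
      using q(2)[of k "k + t"] ij by simp
    moreover have "k + t + P \<le> length w" "k + P \<le> length w"
      using range[of "k + t"] step by auto
    ultimately show ?case
      unfolding factor_add using q(1) by (simp add: length_factor)
  qed
  have "short_powers n 2 (factor w i (b - i))"
  proof (rule periodic_short_powers)
    show "0 < t" "t < n" using t assms by auto
    fix k assume "k + t < length (factor w i (b - i))"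
    then have k: "i + k + t < b" by (auto simp: factor_def)
    then have "factor w (i + k) (Suc q) = factor w (i + k + t) (Suc q)"
      using per[of "i + k"] q(2)[of "i + k" "i + k + t"] ij by simp
    then have "factor w (i + k) (Suc q) ! 0 = factor w (i + k + t) (Suc q) ! 0"
      by simp
    then show "factor w i (b - i) ! k = factor w i (b - i) ! (k + t)"
      using range[OF k] range[of "i + k"] q(1) k by (simp add: factor_def add.assoc)
  qed
  then have "segment_bound n w 2 i b" by (simp add: segment_bound_def)
  moreover have "segment_bound n w (n - 1) a i"
    by (rule segment_bound_mono[OF segment_bound_length]) (use ij assms in auto)
  ultimately have "segment_bound n w (n - 1 + 2) a b"
    using ij False assms by (intro segment_bound_join[of n w _ a i]) auto
  then show ?thesis using assms(4) by (simp add: algebra_simps)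
qed

section \<open>Refining uniform segments\<close>

locale coloured_word =
  fixes w :: "nat list" and n P l :: nat and r :: "nat \<Rightarrow> nat"
  assumes letters: "set w \<subseteq> {..<l}"
    and n_ge: "2 \<le> n" and P_ge: "n \<le> P" and l_pos: "0 < l"
    and colour_less: "i + P \<le> length w \<Longrightarrow> r i < n - 1"
    and colour_mono: "i + P \<le> j \<Longrightarrow> j + P \<le> length w \<Longrightarrow> r i = r j \<Longrightarrow> factor w i P \<le> factor w j P"
begin

definition uniform :: "nat \<Rightarrow> nat \<Rightarrow> nat \<Rightarrow> bool" where
  "uniform q a b \<longleftrightarrow> (\<forall>i\<in>{a..<b}. \<forall>j\<in>{a..<b}. r i = r j \<longrightarrow> factor w i q = factor w j q)"

text \<open>
  The windows start at the records, the positions whose factor exceeds all earlier factors of the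
  same colour.  Records are told apart by colour and factor, which bounds their number by \<open>D\<close>.
  Suppose two positions of the same colour carry different factors.  The first position of that
  colour whose factor is at least the larger of the two is a record, and by the monotonicity of the
  colouring the smaller factor cannot occur \<open>P\<close> or more positions after it.  But a segment that
  avoids the windows and contains both positions would lie beyond the window at this record.
\<close>

lemma segment_bound_refine:
  assumes "q \<le> P" "a \<le> b" and range: "\<And>i. i < b \<Longrightarrow> i + P \<le> length w"
    and D: "card ((\<lambda>i. (r i, factor w i q)) ` {a..<b}) \<le> D"
    and h: "\<And>c d. a \<le> c \<Longrightarrow> d \<le> b \<Longrightarrow> uniform q c d \<Longrightarrow> segment_bound n w h c d"
  shows "segment_bound n w (D * P + (D + 1) * h) a b"
proof -
  define X where "X = {x\<in>{a..<b}. \<forall>y\<in>{a..<x}. r y = r x \<longrightarrow> factor w y q < factor w x q}"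
  have fin: "finite X" by (simp add: X_def)
  have "inj_on (\<lambda>i. (r i, factor w i q)) X"
  proof (rule linorder_inj_onI)
    fix x y assume "x < y" "x \<in> X" "y \<in> X"
    then show "(r x, factor w x q) \<noteq> (r y, factor w y q)"
      by (auto simp: X_def)
  qed auto
  then have "card X = card ((\<lambda>i. (r i, factor w i q)) ` X)"
    by (simp add: card_image)
  also have "\<dots> \<le> card ((\<lambda>i. (r i, factor w i q)) ` {a..<b})"
    by (intro card_mono image_mono) (auto simp: X_def)
  finally have cardX: "card X \<le> D" using D by simp
  have "segment_bound n w (card X * P + (card X + 1) * h) a b"
  proof (rule segment_bound_windows[OF fin n_ge assms(2)])
    fix c d assume cd: "a \<le> c" "c \<le> d" "d \<le> b" and avoid: "\<forall>x\<in>X. \<forall>i\<in>{c..<d}. i \<notin> {x..<x + P}"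
    have not_less: "\<not> factor w i q < factor w j q" if ij: "i \<in> {c..<d}" "j \<in> {c..<d}" "r i = r j" for i j
    proof
      assume less: "factor w i q < factor w j q"
      define x where "x = (LEAST x. a \<le> x \<and> r x = r j \<and> factor w j q \<le> factor w x q)"
      have x: "a \<le> x \<and> r x = r j \<and> factor w j q \<le> factor w x q"
        unfolding x_def by (rule LeastI[of _ j]) (use ij cd in auto)
      have "x \<le> j"
        unfolding x_def by (rule Least_le) (use ij cd in auto)
      have "factor w y q < factor w x q" if "y \<in> {a..<x}" "r y = r x" for y
      proof (rule ccontr)
        assume "\<not> factor w y q < factor w x q"
        then have "a \<le> y \<and> r y = r j \<and> factor w j q \<le> factor w y q"
          using that x by auto
        then have "x \<le> y" unfolding x_def by (rule Least_le)
        then show False using that by simp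
      qed
      then have "x \<in> X"
        using x \<open>x \<le> j\<close> ij cd by (auto simp: X_def)
      have "x + P \<le> c"
      proof (rule ccontr)
        assume "\<not> x + P \<le> c"
        then have "max c x \<in> {c..<d}" "max c x \<in> {x..<x + P}"
          using \<open>x \<le> j\<close> ij n_ge P_ge by auto
        then show False using avoid \<open>x \<in> X\<close> by blast
      qed
      then have xi: "x + P \<le> i" and "i + P \<le> length w"
        using ij cd range by auto
      then have "factor w x P \<le> factor w i P"
        using colour_mono[OF xi] x ij(3) by simp
      then have "factor w x q \<le> factor w i q"
        by (rule factor_mono[rotated 2]) (use assms(1) xi \<open>i + P \<le> length w\<close> in auto)
      also note less
      finally show False using x leD by blast
    qed
    then have "uniform q c d"
      unfolding uniform_def by (metis linorder_neqE)
    then show "segment_bound n w h c d" using h cd by simp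
  qed
  then show ?thesis
    by (rule segment_bound_mono) (use cardX in \<open>auto intro!: add_mono mult_mono\<close>)
qed

lemma uniform_representative:
  assumes "uniform q a b" "i \<in> {a..<b}"
  shows "factor w (SOME j. j \<in> {a..<b} \<and> r j = r i) q = factor w i q"
proof -
  have "\<exists>j. j \<in> {a..<b} \<and> r j = r i" using assms(2) by blast
  from someI_ex[OF this] show ?thesis
    using assms unfolding uniform_def by blast
qed

text \<open>
  The recursion behind this bound is \<open>h\<^sub>0 = n + 1\<close> and \<open>h\<^sub>k\<^sub>+\<^sub>1 = n\<^sup>2 (P + h\<^sub>k)\<close>; adding \<open>P\<close> to the
  initial value makes \<open>h\<^sub>k \<ge> P\<close> and turns the recursion into a multiplication by \<open>2 n\<^sup>2\<close>.
\<close>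

definition cost :: "nat \<Rightarrow> nat" where
  "cost k = (2 * n\<^sup>2) ^ k * (n + 1 + P)"

lemma cost_Suc: "cost (Suc k) = 2 * n\<^sup>2 * cost k"
  by (simp add: cost_def algebra_simps)

lemma P_le_cost: "P \<le> cost k"
proof -
  have "1 * P \<le> (2 * n\<^sup>2) ^ k * (n + 1 + P)"
    using n_ge by (intro mult_mono) auto
  then show ?thesis by (simp add: cost_def)
qed

text \<open>
  In a \<open>q\<close>-uniform segment the factor of length \<open>2 q\<close> at \<open>i\<close> is determined by the colours of \<open>i\<close> and
  \<open>i + q\<close>, provided that \<open>i + q\<close> is still in the segment; the last \<open>q\<close> positions are therefore split
  off as single letters.
\<close>

lemma uniform_segment_bound:
  assumes "q * 2 ^ k = P" "uniform q a b" "\<And>i. i < b \<Longrightarrow> i + P \<le> length w"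
  shows "segment_bound n w (cost k) a b"
  using assms
proof (induction k arbitrary: q a b)
  case 0
  \<comment> \<open>there are no more factors of length \<open>P\<close> than colours\<close>
  define S where "S = (\<lambda>i. factor w i P) ` {a..<b}"
  have S: "S = (\<lambda>c. factor w (SOME i. i \<in> {a..<b} \<and> r i = c) P) ` r ` {a..<b}"
    unfolding S_def image_image
  proof (rule image_cong[OF refl])
    fix i assume "i \<in> {a..<b}"
    then show "factor w i P = factor w (SOME j. j \<in> {a..<b} \<and> r j = r i) P"
      using uniform_representative[of q a b i] 0 by simp
  qed
  have "r ` {a..<b} \<subseteq> {..<n - 1}"
    using colour_less 0 by auto
  then have "card (r ` {a..<b}) \<le> n - 1"
    using card_mono[of "{..<n - 1}" "r ` {a..<b}"] by simp
  then have "card S \<le> n - 1"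
    unfolding S by (rule order_trans[OF card_image_le, rotated]) simp
  then have "segment_bound n w (n + 1) a b"
    using n_ge P_ge 0 unfolding S_def by (intro few_factors_segment_bound[of w P a b "n - 1"]) auto
  then show ?case
    by (rule segment_bound_mono) (simp add: cost_def)
next
  case (Suc k)
  have q: "q \<le> P" "2 * q \<le> P" "0 < q"
  proof -
    have "2 * q * 1 \<le> 2 * q * 2 ^ k" by (intro mult_left_mono) auto
    then show "2 * q \<le> P" using Suc.prems(1) by (simp add: ac_simps)
    then show "q \<le> P" by simp
    show "0 < q" using Suc.prems(1) n_ge P_ge by (cases q) auto
  qed
  show ?case
  proof (cases "a \<le> b")
    case False
    then have "segment_bound n w 0 a b"
      using segment_bound_length[OF n_ge, of w b a] by simp
    then show ?thesis by (rule segment_bound_mono) simp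
  next
    case True
    define c where "c = max a (b - q)"
    have c: "a \<le> c" "c \<le> b" "b - c \<le> q" "\<And>i. i \<in> {a..<c} \<Longrightarrow> i + q < b"
      using True by (auto simp: c_def)
    define D where "D = (n - 1) * (n - 1)"
    \<comment> \<open>the colour and the factor of length \<open>2 q\<close>, computed from two colours\<close>
    define g where "g = (\<lambda>(x, y). (x, factor w (SOME i. i \<in> {a..<b} \<and> r i = x) q @
                                      factor w (SOME i. i \<in> {a..<b} \<and> r i = y) q))"
    note rep = uniform_representative[OF Suc.prems(2)]
    have "(\<lambda>i. (r i, factor w i (2 * q))) ` {a..<c} \<subseteq> g ` ({..<n - 1} \<times> {..<n - 1})"
    proof
      fix z assume "z \<in> (\<lambda>i. (r i, factor w i (2 * q))) ` {a..<c}"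
      then obtain i where i: "i \<in> {a..<c}" "z = (r i, factor w i (2 * q))" by auto
      have "z = g (r i, r (i + q))"
        using i c rep[of i] rep[of "i + q"] by (simp add: g_def mult_2 factor_add)
      moreover have "r i < n - 1" "r (i + q) < n - 1"
        using i(1) c(2) c(4)[OF i(1)] Suc.prems(3)[of i] Suc.prems(3)[of "i + q"]
        by (auto intro!: colour_less simp del: One_nat_def)
      ultimately show "z \<in> g ` ({..<n - 1} \<times> {..<n - 1})" by blast
    qed
    then have "card ((\<lambda>i. (r i, factor w i (2 * q))) ` {a..<c}) \<le> card ({..<n - 1} \<times> {..<n - 1})"
      by (rule surj_card_le[rotated]) simp
    then have "segment_bound n w (D * P + (D + 1) * cost k) a c"
      using q c Suc.prems
      by (intro segment_bound_refine[of "2 * q"] Suc.IH[of "2 * q"]) (auto simp: D_def)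
    moreover have "segment_bound n w P c b"
      by (rule segment_bound_mono[OF segment_bound_length[OF n_ge]]) (use c q in auto)
    ultimately have "segment_bound n w (D * P + (D + 1) * cost k + P) a b"
      by (rule segment_bound_join) (use c in auto)
    moreover have "D * P + (D + 1) * cost k + P \<le> cost (Suc k)"
    proof -
      have "D * P + (D + 1) * cost k + P = (D + 1) * (P + cost k)"
        by (simp add: algebra_simps)
      also have "\<dots> \<le> n\<^sup>2 * (cost k + cost k)"
      proof (intro mult_mono add_mono P_le_cost)
        obtain m where "n = Suc m" using n_ge by (cases n) auto
        then show "D + 1 \<le> n\<^sup>2" by (simp add: D_def power2_eq_square)
      qed auto
      also have "\<dots> = cost (Suc k)" by (simp add: cost_Suc)
      finally show ?thesis .
    qed
    ultimately show ?thesis by (rule segment_bound_mono)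
  qed
qed

text \<open>
  The \<open>1\<close>-uniform segments come from the same refinement, applied to the whole range of positions,
  where colour and letter take at most \<open>(n - 1) l\<close> values.  The positions too close to the end of the
  word to start a factor of length \<open>P\<close> are counted letter by letter.
\<close>

lemma short_powers_bound:
  assumes "P = 2 ^ m"
  shows "short_powers n (3 * n * l * cost m) w"
proof -
  define b where "b = length w + 1 - P"
  define D where "D = (n - 1) * l"
  have range: "i + P \<le> length w" if "i < b" for i
    using that by (auto simp: b_def)
  have "(\<lambda>i. (r i, factor w i 1)) ` {0..<b} \<subseteq> (\<lambda>(x, y). (x, [y])) ` ({..<n - 1} \<times> {..<l})"
  proof
    fix z assume "z \<in> (\<lambda>i. (r i, factor w i 1)) ` {0..<b}"
    then obtain i where i: "i < b" "z = (r i, factor w i 1)" by auto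
    then have "i < length w" using range n_ge P_ge by force
    then have "factor w i 1 = [w ! i]" "w ! i < l"
      using letters by (auto simp: factor_def take_Suc_conv_app_nth nth_mem subset_iff)
    then show "z \<in> (\<lambda>(x, y). (x, [y])) ` ({..<n - 1} \<times> {..<l})"
      using i colour_less range by auto
  qed
  then have "card ((\<lambda>i. (r i, factor w i 1)) ` {0..<b}) \<le> card ({..<n - 1} \<times> {..<l})"
    by (rule surj_card_le[rotated]) simp
  then have "segment_bound n w (D * P + (D + 1) * cost m) 0 b"
    using n_ge P_ge range assms
    by (intro segment_bound_refine[of 1] uniform_segment_bound[of 1]) (auto simp: D_def)
  moreover have "segment_bound n w P b (length w)"
    by (rule segment_bound_mono[OF segment_bound_length[OF n_ge]]) (auto simp: b_def)
  ultimately have "segment_bound n w (D * P + (D + 1) * cost m + P) 0 (length w)"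
    by (rule segment_bound_join) (use P_ge n_ge in \<open>auto simp: b_def\<close>)
  moreover have "D * P + (D + 1) * cost m + P \<le> 3 * n * l * cost m"
  proof -
    have "D + 1 \<le> n * l"
    proof -
      have "n * l = D + l" using n_ge by (simp add: D_def diff_mult_distrib)
      then show ?thesis using l_pos by simp
    qed
    then have "(D + 1) * (P + cost m) \<le> n * l * (cost m + cost m)"
      by (intro mult_mono add_mono P_le_cost) auto
    then show ?thesis by (simp add: algebra_simps)
  qed
  ultimately show ?thesis
    unfolding segment_bound_def by (auto simp: factor_def intro: short_powers_mono)
qed

end

lemma nondivisible_short_powers:
  assumes "\<not> divisible n w" "w \<noteq> []" "set w \<subseteq> {..<l}" "n \<le> 2 ^ m"
  shows "short_powers n (3 * n * l * ((2 * n\<^sup>2) ^ m * (n + 1 + 2 ^ m))) w"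
proof -
  have "n \<noteq> 0"
    using assms(1) divisible_0 by metis
  moreover have "n \<noteq> 1"
    using assms(1,2) unfolding divisible_def
    by (auto dest!: spec[of _ "[]"] spec[of _ "[w]"])
  ultimately have n: "2 \<le> n" by simp
  obtain r :: "nat \<Rightarrow> nat" where r:
    "\<And>i. i + 2 ^ m \<le> length w \<Longrightarrow> r i < n - 1"
    "\<And>i j. i + 2 ^ m \<le> j \<Longrightarrow> j + 2 ^ m \<le> length w \<Longrightarrow> r i = r j \<Longrightarrow>
       factor w i (2 ^ m) \<le> factor w j (2 ^ m)"
    using nondivisible_colouring[OF assms(1), of "2 ^ m"] by (metis zero_less_numeral zero_less_power)
  interpret coloured_word w n "2 ^ m" l r
  proof
    show "0 < l" using assms(2,3) by (cases w) auto
  qed (use assms n r in auto)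
  show ?thesis
    using short_powers_bound[OF refl] by (simp only: cost_def)
qed

text \<open>
  For the least \<open>m\<close> with \<open>n \<le> 2\<^sup>m\<close> one has \<open>2\<^sup>m \<le> 2 n\<close>, whence the left-hand side is at most
  \<open>24 l n powr (5 + 2 log\<^sub>2 n)\<close>.
\<close>

lemma height_le_Phi:
  assumes "0 < n"
  obtains m :: nat where "n \<le> 2 ^ m"
    "real (3 * n * l * ((2 * n\<^sup>2) ^ m * (n + 1 + 2 ^ m))) \<le> Phi n l"
proof -
  define N where "N = real n"
  have N: "1 \<le> N" using assms by (simp add: N_def)
  define m where "m = (LEAST m. n \<le> 2 ^ m)"
  have m: "n \<le> 2 ^ m"
    unfolding m_def by (rule LeastI[of _ n]) (simp add: less_imp_le)
  have m2: "2 ^ m \<le> 2 * N"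
  proof (cases m)
    case 0
    then show ?thesis using N by simp
  next
    case (Suc k)
    then have "\<not> n \<le> 2 ^ k"
      using not_less_Least[of k "\<lambda>m. n \<le> 2 ^ m"] by (simp add: m_def)
    then have "real (2 ^ k) \<le> real n" by (intro of_nat_mono) simp
    then show ?thesis using Suc by (simp add: N_def)
  qed
  have "real m \<le> log 2 (2 * N)"
    using m2 N by (simp add: le_log_iff powr_realpow)
  also have "\<dots> = 1 + log 2 N"
    using N by (simp add: log_mult)
  also have "log 2 N \<le> 2 * log 3 N"
  proof -
    \<comment> \<open>this is \<open>3 \<le> 2\<^sup>2\<close>\<close>
    have "ln 3 \<le> ln (2 ^ 2 :: real)" by (subst ln_le_cancel_iff) auto
    then have "ln (3::real) \<le> 2 * ln 2" by (subst (asm) ln_realpow) auto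
    then have "ln N * ln 3 \<le> ln N * (2 * ln 2)"
      using N by (intro mult_left_mono) auto
    then show ?thesis by (simp add: log_def field_simps)
  qed
  finally have m_le: "real m \<le> 1 + 2 * log 3 N" by simp
  have log_pos: "0 \<le> log 3 N" "0 \<le> log 3 (4::real)" using N by simp_all
  have "N ^ (2 * m) = N powr real (2 * m)"
    using N by (intro powr_realpow[symmetric]) simp
  also have "\<dots> \<le> N powr (2 + 4 * log 3 N)"
    using N m_le by (intro powr_mono) auto
  finally have pow: "N ^ (2 * m) \<le> N powr (2 + 4 * log 3 N)" .
  have "real (3 * n * l * ((2 * n\<^sup>2) ^ m * (n + 1 + 2 ^ m))) =
        3 * N * real l * ((2 * N\<^sup>2) ^ m * (N + 1 + 2 ^ m))"
    unfolding N_def by (simp only: of_nat_mult of_nat_add of_nat_power of_nat_numeral of_nat_1)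
  also have "(2 * N\<^sup>2) ^ m = 2 ^ m * N ^ (2 * m)"
    by (simp only: power_mult_distrib power_mult)
  also have "3 * N * real l * (2 ^ m * N ^ (2 * m) * (N + 1 + 2 ^ m)) \<le>
             3 * N * real l * (2 * N * N powr (2 + 4 * log 3 N) * (4 * N))"
    using pow N m2 by (intro mult_left_mono mult_mono) auto
  also have "\<dots> = 24 * real l * (N powr 3 * N powr (2 + 4 * log 3 N))"
    using N by (simp add: powr_numeral power3_eq_cube)
  also have "\<dots> = 24 * real l * N powr (5 + 4 * log 3 N)"
    by (simp flip: powr_add)
  also have "\<dots> \<le> E1 * real l * N powr (E2 + 12 * log 3 N)"
  proof (intro mult_mono powr_mono)
    have "(24::real) \<le> 4 powr 3" by (simp add: powr_numeral)
    also have "\<dots> \<le> E1"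
      unfolding E1_def using log_pos by (intro powr_mono) auto
    finally show "24 \<le> E1" .
    show "5 + 4 * log 3 N \<le> E2 + 12 * log 3 N"
      unfolding E2_def using log_pos by simp
  qed (use N in \<open>auto simp: E1_def\<close>)
  also have "\<dots> = Phi n l" by (simp add: Phi_def N_def)
  finally show ?thesis using m that by blast
qed

section \<open>Values of words\<close>

lemma word_val_Cons: "w \<noteq> [] \<Longrightarrow> word_val s (x # w) = s x * word_val s w"
  by (cases w) auto

lemma word_val_append:
  "u \<noteq> [] \<Longrightarrow> v \<noteq> [] \<Longrightarrow> word_val s (u @ v) = word_val s u * word_val s v"
  by (induction u rule: list_nonempty_induct) (simp_all add: word_val_Cons mult.assoc)

lemma word_val_concat:
  assumes "u \<noteq> []" "\<And>j. j \<in> set u \<Longrightarrow> g j \<noteq> []"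
  shows "word_val s (concat (map g u)) = word_val (\<lambda>j. word_val s (g j)) u"
  using assms
proof (induction u rule: list_nonempty_induct)
  case (cons j u)
  moreover from this have "concat (map g u) \<noteq> []"
    by (cases u) auto
  ultimately show ?case
    by (simp add: word_val_append word_val_Cons)
qed simp

text \<open>
  Each letter is replaced by a sum over the indices that \<open>c\<close> assigns to it; expanding the product picks one
  index for every position of the word.
\<close>

lemma word_val_sum:
  assumes "v \<noteq> []"
  shows "word_val (\<lambda>i. \<Sum>j | j \<in> S \<and> c j = i. X j) v =
         (\<Sum>u | set u \<subseteq> S \<and> map c u = v. word_val X u)"
  using assms
proof (induction v rule: list_nonempty_induct)
  case (single i)
  have "{u. set u \<subseteq> S \<and> map c u = [i]} = (\<lambda>j. [j]) ` {j. j \<in> S \<and> c j = i}"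
    by auto
  then show ?case by (simp add: sum.reindex inj_on_def)
next
  case (cons i v)
  let ?J = "{j. j \<in> S \<and> c j = i}" and ?U = "{u. set u \<subseteq> S \<and> map c u = v}"
  have U: "{u. set u \<subseteq> S \<and> map c u = i # v} = (\<lambda>(j, u). j # u) ` (?J \<times> ?U)"
    by (auto simp: map_eq_Cons_conv)
  have "(\<Sum>u | set u \<subseteq> S \<and> map c u = i # v. word_val X u) =
        (\<Sum>(j, u)\<in>?J \<times> ?U. word_val X (j # u))"
    unfolding U by (subst sum.reindex) (auto simp: inj_on_def case_prod_beta)
  also have "\<dots> = (\<Sum>(j, u)\<in>?J \<times> ?U. X j * word_val X u)"
    using cons.hyps by (intro sum.cong) (auto intro!: word_val_Cons)
  also have "\<dots> = (\<Sum>j\<in>?J. X j) * (\<Sum>u\<in>?U. word_val X u)"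
    by (simp add: sum_product sum.cartesian_product)
  finally show ?case
    using cons by (simp add: word_val_Cons)
qed

section \<open>Rearranging decreasing blocks\<close>

lemma lex_below_context: "u \<prec> v \<Longrightarrow> p @ u @ y \<prec> p @ v @ z"
  unfolding lex_below_def by (metis append.assoc append_Cons)

text \<open>
  At the first place where the order of the blocks changes, the block is replaced by a later one,
  hence by a smaller one.
\<close>

lemma rearrangement_lex_below:
  assumes sorted: "sorted_wrt (\<lambda>u v. v \<prec> u) ws"
    and perm: "distinct u" "set u = {..<length ws}" "u \<noteq> [0..<length ws]"
  shows "concat (map ((!) ws) u) \<prec> concat ws"
proof -
  have len: "length u = length ws"
    using distinct_card[OF perm(1)] perm(2) by simp
  define i where "i = (LEAST i. i < length ws \<and> u ! i \<noteq> i)"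
  have "\<exists>i. i < length ws \<and> u ! i \<noteq> i"
  proof (rule ccontr)
    assume "\<not> ?thesis"
    then have "u = [0..<length ws]" using len by (intro nth_equalityI) auto
    then show False using perm(3) by simp
  qed
  then have i: "i < length ws \<and> u ! i \<noteq> i"
    unfolding i_def by (rule LeastI_ex)
  have before: "u ! k = k" if "k < i" for k
    using not_less_Least[of k "\<lambda>i. i < length ws \<and> u ! i \<noteq> i"] that i by (auto simp: i_def)
  have "u ! i < length ws"
    using i len perm(2) by (metis lessThan_iff nth_mem)
  moreover have "i < u ! i"
  proof (rule ccontr)
    assume "\<not> i < u ! i"
    then have "u ! i < i" using i by simp
    then have "u ! (u ! i) = u ! i" by (rule before)
    then show False
      using perm(1) i len \<open>u ! i < i\<close> by (metis nth_eq_iff_index_eq order_less_trans less_irrefl)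
  qed
  ultimately have below: "ws ! (u ! i) \<prec> ws ! i"
    using sorted_wrt_nth_less[OF sorted] by blast
  have "take i (map ((!) ws) u) = take i ws"
    using i len before by (intro nth_equalityI) auto
  then have "map ((!) ws) u = take i ws @ ws ! (u ! i) # drop (Suc i) (map ((!) ws) u)"
    using id_take_nth_drop[of i "map ((!) ws) u"] i len by simp
  then have "concat (map ((!) ws) u) =
      concat (take i ws) @ ws ! (u ! i) @ concat (drop (Suc i) (map ((!) ws) u))"
    by (metis concat.simps(2) concat_append)
  moreover have "concat ws = concat (take i ws) @ ws ! i @ concat (drop (Suc i) ws)"
    using id_take_nth_drop[of i ws] i by (metis concat.simps(2) concat_append)
  ultimately show ?thesis using lex_below_context[OF below] by metis
qed

lemma rearrangement_set_length:
  assumes "distinct u" "set u = {..<length ws}"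
  shows "set (concat (map ((!) ws) u)) = set (concat ws)"
    and "length (concat (map ((!) ws) u)) = length (concat ws)"
proof -
  have "((!) ws) ` set u = set ws"
    using assms(2) by (auto simp: set_conv_nth)
  then show "set (concat (map ((!) ws) u)) = set (concat ws)" by simp
  have "length (concat (map ((!) ws) u)) = (\<Sum>j\<in>set u. length (ws ! j))"
    using assms(1) by (simp add: length_concat sum_list_distinct_conv_sum_set o_def)
  also have "\<dots> = length (concat ws)"
    using assms(2) by (simp add: length_concat sum_list_sum_nth atLeast0LessThan)
  finally show "length (concat (map ((!) ws) u)) = length (concat ws)" .
qed

section \<open>Reduction to nondivisible words\<close>

context assoc_algebra
begin

text \<open>
  Substitute for each variable the sum of the elements \<open>X j\<close> assigned to it by \<open>c\<close>, with \<open>j\<close> ranging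
  over a set \<open>S\<close>.  The expansion vanishes for every finite \<open>S\<close>, hence so does the part of it that
  involves all indices of \<open>S\<close> (the inclusion-exclusion principle, here by induction on \<open>S\<close>).  For
  \<open>n\<close> indices and degree at most \<open>n\<close>, the monomials of that part use each index exactly once.
\<close>

lemma multilinear_part_vanishes:
  fixes X :: "nat \<Rightarrow> 'a"
  assumes ident: "satisfies_identity scale f" and const: "[] \<notin> Poly_Mapping.keys f"
    and deg: "\<And>v. v \<in> Poly_Mapping.keys f \<Longrightarrow> length v \<le> n" and "0 < n"
  shows "(\<Sum>u | distinct u \<and> set u = {..<n}.
           scale (Poly_Mapping.lookup f (map c u)) (word_val X u)) = 0"
proof -
  define h where "h u = scale (Poly_Mapping.lookup f (map c u)) (word_val X u)" for u
  define U where "U S = {u. set u \<subseteq> S \<and> length u \<le> n \<and> u \<noteq> []}" for S :: "nat set"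
  have finU: "finite (U S)" if "finite S" for S
    by (rule finite_subset[OF _ finite_lists_length_le[OF that, of n]]) (auto simp: U_def)
  have all_zero: "sum h (U S) = 0" if "finite S" for S
  proof -
    let ?s = "\<lambda>i. \<Sum>j | j \<in> S \<and> c j = i. X j" and ?V = "{u \<in> U S. map c u \<in> Poly_Mapping.keys f}"
    have "0 = (\<Sum>v\<in>Poly_Mapping.keys f. scale (Poly_Mapping.lookup f v) (word_val ?s v))"
      using ident unfolding satisfies_identity_def by metis
    also have "\<dots> = (\<Sum>v\<in>Poly_Mapping.keys f. \<Sum>u | u \<in> ?V \<and> map c u = v. h u)"
    proof (intro sum.cong refl)
      fix v assume v: "v \<in> Poly_Mapping.keys f"
      then have "v \<noteq> []" using const by auto
      moreover have "{u. set u \<subseteq> S \<and> map c u = v} = {u. u \<in> ?V \<and> map c u = v}"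
        using v deg[OF v] \<open>v \<noteq> []\<close> by (auto simp: U_def)
      ultimately show "scale (Poly_Mapping.lookup f v) (word_val ?s v) = (\<Sum>u | u \<in> ?V \<and> map c u = v. h u)"
        by (auto simp: word_val_sum scale_sum_right h_def intro!: sum.cong)
    qed
    also have "\<dots> = sum h ?V"
      using finU[OF that] by (subst sum.group) auto
    also have "\<dots> = sum h (U S)"
      using finU[OF that] by (intro sum.mono_neutral_left) (auto simp: h_def in_keys_iff)
    finally show ?thesis by simp
  qed
  define E where "E T = {u. set u = T \<and> length u \<le> n \<and> u \<noteq> []}" for T :: "nat set"
  have exact_zero: "sum h (E S) = 0" if "finite S" for S
    using that
  proof (induction S rule: finite_psubset_induct)
    case (psubset S)
    have "sum h (U S) = (\<Sum>T\<in>Pow S. \<Sum>u | u \<in> U S \<and> set u = T. h u)"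
      using psubset.hyps finU by (subst sum.group) (auto simp: U_def)
    also have "\<dots> = (\<Sum>T\<in>Pow S. sum h (E T))"
      by (intro sum.cong) (auto simp: U_def E_def)
    also have "\<dots> = sum h (E S) + (\<Sum>T\<in>Pow S - {S}. sum h (E T))"
      using psubset.hyps by (intro sum.remove[of "Pow S" S]) auto
    also have "(\<Sum>T\<in>Pow S - {S}. sum h (E T)) = 0"
      by (rule sum.neutral, rule ballI, rule psubset.IH) auto
    finally show ?case using all_zero[OF psubset.hyps] by simp
  qed
  have "{u. distinct u \<and> set u = {..<n}} = E {..<n}"
  proof -
    have "distinct u \<longleftrightarrow> length u \<le> n \<and> u \<noteq> []" if "set u = {..<n}" for u
    proof -
      have card: "card (set u) = n" using that by simp
      then have "u \<noteq> []" using \<open>0 < n\<close> by force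
      moreover have "distinct u \<longleftrightarrow> length u = n"
        using distinct_card[of u] card_distinct[of u] card by metis
      moreover have "n \<le> length u" using card_length[of u] card by simp
      ultimately show ?thesis by auto
    qed
    then show ?thesis unfolding E_def by blast
  qed
  then show ?thesis using exact_zero[of "{..<n}"] by (simp add: h_def)
qed

text \<open>
  Assigning the index \<open>j\<close> to the \<open>j\<close>-th letter of the monomial with coefficient one makes this
  monomial the only source of the identical order.
\<close>

lemma admissible_identity_reorders:
  assumes "admissible f" "ncdegree f = n" "satisfies_identity scale f" "0 < n"
  shows "\<exists>c. \<forall>X. word_val X [0..<n] =
       - (\<Sum>u | distinct u \<and> set u = {..<n} \<and> u \<noteq> [0..<n]. scale (c u) (word_val X u))"
proof -
  have const: "[] \<notin> Poly_Mapping.keys f"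
    using assms(1) by (simp add: admissible_def)
  obtain w where w: "length w = n" "Poly_Mapping.lookup f w = 1"
    using assms(1,2) by (auto simp: admissible_def)
  have deg: "length v \<le> n" if "v \<in> Poly_Mapping.keys f" for v
    unfolding assms(2)[symmetric] ncdegree_def using that by (intro Max_ge) auto
  show ?thesis
  proof (rule exI[of _ "\<lambda>u. Poly_Mapping.lookup f (map ((!) w) u)"], rule allI)
    fix X :: "nat \<Rightarrow> 'a"
    let ?P = "{u. distinct u \<and> set u = {..<n}}"
    let ?h = "\<lambda>u. scale (Poly_Mapping.lookup f (map ((!) w) u)) (word_val X u)"
    have "finite ?P"
    proof (rule finite_subset)
      show "?P \<subseteq> {u. set u \<subseteq> {..<n} \<and> length u = n}"
        using distinct_card by fastforce
      show "finite {u. set u \<subseteq> {..<n} \<and> length u = n}"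
        by (rule finite_lists_length_eq) simp
    qed
    moreover have "[0..<n] \<in> ?P" by (simp add: atLeast0LessThan)
    ultimately have "sum ?h ?P = ?h [0..<n] + sum ?h (?P - {[0..<n]})"
      by (rule sum.remove[where g = ?h])
    moreover have "sum ?h ?P = 0"
      using multilinear_part_vanishes[OF assms(3) const deg assms(4)] by simp
    moreover have "?h [0..<n] = word_val X [0..<n]"
      using w map_nth[of w] by simp
    moreover have "?P - {[0..<n]} = {u. distinct u \<and> set u = {..<n} \<and> u \<noteq> [0..<n]}"
      by auto
    ultimately show "word_val X [0..<n] =
       - (\<Sum>u | distinct u \<and> set u = {..<n} \<and> u \<noteq> [0..<n]. ?h u)"
      by (simp add: eq_neg_iff_add_eq_0)
  qed
qed

text \<open>
  The identity is applied to the values of the blocks and multiplied by the rest of the word.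
\<close>

lemma divisible_in_span_smaller:
  assumes "admissible f" "ncdegree f = n" "satisfies_identity scale f" "0 < n" "divisible n w"
  shows "word_val a w \<in> span (word_val a ` {v. v \<prec> w \<and> length v = length w \<and> set v = set w})"
proof -
  obtain c :: "nat list \<Rightarrow> 'k" where c: "\<And>X :: nat \<Rightarrow> 'a. word_val X [0..<n] =
       - (\<Sum>u | distinct u \<and> set u = {..<n} \<and> u \<noteq> [0..<n]. scale (c u) (word_val X u))"
    using admissible_identity_reorders[OF assms(1-4)] by blast
  obtain x ws y where w: "w = x @ concat ws @ y" and ws: "length ws = n" "[] \<notin> set ws"
      "sorted_wrt (\<lambda>u v. v \<prec> u) ws"
    using assms(5) unfolding divisible_def by blast
  define R where "R u = concat (map ((!) ws) u)" for u
  \<comment> \<open>multiplication by the values of \<open>x\<close> and \<open>y\<close>, either of which may be the empty word\<close>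
  define L where "L z = (let z' = (if x = [] then z else word_val a x * z)
                         in if y = [] then z' else z' * word_val a y)" for z
  have L_word: "word_val a (x @ v @ y) = L (word_val a v)" if "v \<noteq> []" for v
    using that by (auto simp: L_def Let_def word_val_append mult.assoc)
  have L_sum: "L (- (\<Sum>u\<in>A. scale (k u) (g u))) = - (\<Sum>u\<in>A. scale (k u) (L (g u)))"
    for A and k :: "nat list \<Rightarrow> 'k" and g
    by (simp add: L_def Let_def sum_distrib_left sum_distrib_right scale_mult_left scale_mult_right)
  have R_ne: "R u \<noteq> []" and R_val: "word_val a (R u) = word_val (\<lambda>j. word_val a (ws ! j)) u"
    if "set u = {..<n}" for u
  proof -
    have u: "u \<noteq> []" "\<And>j. j \<in> set u \<Longrightarrow> ws ! j \<noteq> []"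
    proof -
      show "u \<noteq> []" using that assms(4) by force
      show "ws ! j \<noteq> []" if "j \<in> set u" for j
        using that \<open>set u = {..<n}\<close> ws(1,2) by (metis lessThan_iff nth_mem)
    qed
    then show "R u \<noteq> []" unfolding R_def by (cases u) auto
    show "word_val a (R u) = word_val (\<lambda>j. word_val a (ws ! j)) u"
      unfolding R_def using u by (rule word_val_concat)
  qed
  have R_id: "R [0..<n] = concat ws"
    using ws(1) map_nth[of ws] by (simp add: R_def)
  have up: "set [0..<n] = {..<n}" by (simp add: atLeast0LessThan)
  have "word_val a w = L (word_val a (R [0..<n]))"
    using L_word[OF R_ne[OF up]] by (simp add: R_id w)
  also have "\<dots> = - (\<Sum>u | distinct u \<and> set u = {..<n} \<and> u \<noteq> [0..<n].
      scale (c u) (L (word_val (\<lambda>j. word_val a (ws ! j)) u)))"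
    unfolding R_val[OF up] c by (rule L_sum)
  also have "\<dots> = - (\<Sum>u | distinct u \<and> set u = {..<n} \<and> u \<noteq> [0..<n].
      scale (c u) (word_val a (x @ R u @ y)))"
    by (intro arg_cong[of _ _ uminus] sum.cong refl) (simp add: L_word R_ne R_val)
  also have "\<dots> \<in> span (word_val a ` {v. v \<prec> w \<and> length v = length w \<and> set v = set w})"
  proof (intro span_neg span_sum span_scale span_base imageI)
    fix u assume "u \<in> {u. distinct u \<and> set u = {..<n} \<and> u \<noteq> [0..<n]}"
    then have u: "distinct u" "set u = {..<length ws}" "u \<noteq> [0..<length ws]"
      using ws(1) by auto
    show "x @ R u @ y \<in> {v. v \<prec> w \<and> length v = length w \<and> set v = set w}"
      using lex_below_context[OF rearrangement_lex_below[OF ws(3) u]] rearrangement_set_length[OF u(1,2)]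
      by (simp add: R_def w)
  qed
  finally show ?thesis .
qed

lemma word_val_in_span_nondivisible:
  assumes "admissible f" "ncdegree f = n" "satisfies_identity scale f" "0 < n" "w \<in> words l"
  shows "word_val a w \<in> span (word_val a ` {v \<in> words l. \<not> divisible n v})"
  using assms(5)
proof (induction w rule: wf_induct_rule[OF wf_lex[OF wf_less_than]])
  case (1 w)
  show ?case
  proof (cases "divisible n w")
    case False
    then show ?thesis using 1(2) by (intro span_base) auto
  next
    case True
    have "word_val a v \<in> span (word_val a ` {v \<in> words l. \<not> divisible n v})"
      if "v \<prec> w" "length v = length w" "set v = set w" for v
    proof (rule 1(1))
      show "(v, w) \<in> lex less_than"
        using that(1,2) unfolding lex_conv lex_below_def by auto
      show "v \<in> words l"
        using 1(2) that by (auto simp: words_def)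
    qed
    then have "word_val a ` {v. v \<prec> w \<and> length v = length w \<and> set v = set w}
        \<subseteq> span (word_val a ` {v \<in> words l. \<not> divisible n v})"
      by auto
    then show ?thesis
      using divisible_in_span_smaller[OF assms(1-4) True] span_minimal subspace_span by blast
  qed
qed

lemma span_image_finite_sum:
  assumes "z \<in> span (g ` Z)"
  obtains m and \<alpha> :: "nat \<Rightarrow> 'k" and b where
    "\<And>i. i < m \<Longrightarrow> b i \<in> Z" "z = (\<Sum>i<m. scale (\<alpha> i) (g (b i)))"
proof -
  obtain T k where T: "finite T" "T \<subseteq> g ` Z" "z = (\<Sum>v\<in>T. scale (k v) v)"
    using assms unfolding span_explicit by auto
  obtain e where e: "bij_betw e {..<card T} T"
    using ex_bij_betw_nat_finite[OF T(1)] by (auto simp: atLeast0LessThan)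
  define b where "b i = (SOME y. y \<in> Z \<and> g y = e i)" for i
  have b: "b i \<in> Z \<and> g (b i) = e i" if "i < card T" for i
  proof -
    have "e i \<in> T" using e that by (auto simp: bij_betw_def)
    then have "e i \<in> g ` Z" using T(2) by blast
    then have "\<exists>y. y \<in> Z \<and> g y = e i" by (auto simp: image_iff)
    then show ?thesis unfolding b_def by (rule someI_ex)
  qed
  have "z = (\<Sum>i<card T. scale (k (e i)) (e i))"
    unfolding T(3) by (rule sum.reindex_bij_betw[OF e, symmetric])
  also have "\<dots> = (\<Sum>i<card T. scale (k (e i)) (g (b i)))"
    using b by (intro sum.cong) auto
  finally show ?thesis using b that[of "card T" b "\<lambda>i. k (e i)"] by simp
qed

end

lemma short_powers_power_products:
  assumes "short_powers n h v" "v \<in> words l"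
  shows "\<exists>B\<in>power_products {u \<in> words l. length u < n} h. power_product B = v"
proof -
  obtain B where B: "power_product B = v" "length B \<le> h"
      "\<forall>(u, k)\<in>set B. u \<noteq> [] \<and> length u < n \<and> 0 < k"
    using assms(1) unfolding short_powers_def by blast
  have "set u \<subseteq> {..<l}" if "(u, k) \<in> set B" for u k
  proof -
    have "0 < k" using B(3) that by blast
    then have "set u \<subseteq> set v"
      using that unfolding B(1)[symmetric] power_product_def by (cases k) force+
    then show ?thesis using assms(2) by (auto simp: words_def)
  qed
  moreover have "B \<noteq> []"
    using B(1) assms(2) by (auto simp: words_def power_product_def)
  ultimately have "B \<in> power_products {u \<in> words l. length u < n} h"
    using B unfolding power_products_def words_def by auto
  then show ?thesis using B(1) by blast
qed

section \<open>The height bound\<close>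

theorem corollary1p4:
  fixes scale :: "'k::field \<Rightarrow> 'a::ring \<Rightarrow> 'a"
    and a :: "nat \<Rightarrow> 'a"
    and f :: "'k ncpoly"
    and n l :: nat
  assumes "n > 0" and "l > 0"
    and "assoc_algebra scale"
    and "generated_by scale l a"
    and "admissible f" and "ncdegree f = n"
    and "satisfies_identity scale f"
  shows "\<exists>h. has_height scale l a {u \<in> words l. length u < n} h \<and> real h \<le> Phi n l"
proof -
  interpret assoc_algebra scale by fact
  let ?Y = "{u \<in> words l. length u < n}"
  obtain m where m: "n \<le> 2 ^ m" "real (3 * n * l * ((2 * n\<^sup>2) ^ m * (n + 1 + 2 ^ m))) \<le> Phi n l"
    using height_le_Phi[OF assms(1)] by blast
  define H where "H = 3 * n * l * ((2 * n\<^sup>2) ^ m * (n + 1 + 2 ^ m))"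
  have "height_bound scale l a ?Y H"
    unfolding height_bound_def
  proof
    fix x assume x: "x \<in> words l"
    have "word_val a ` {v \<in> words l. \<not> divisible n v} \<subseteq>
          (\<lambda>B. word_val a (power_product B)) ` power_products ?Y H"
    proof clarify
      fix v assume v: "v \<in> words l" "\<not> divisible n v"
      then have "short_powers n H v"
        unfolding H_def using m(1) by (intro nondivisible_short_powers) (auto simp: words_def)
      then obtain B where "B \<in> power_products ?Y H" "power_product B = v"
        using short_powers_power_products v(1) by blast
      then show "word_val a v \<in> (\<lambda>B. word_val a (power_product B)) ` power_products ?Y H"
        by blast
    qed
    then have "word_val a x \<in> span ((\<lambda>B. word_val a (power_product B)) ` power_products ?Y H)"
      using word_val_in_span_nondivisible[OF assms(5,6,7,1) x] span_mono by blast
    then show "\<exists>m (\<alpha> :: nat \<Rightarrow> 'k) B. (\<forall>i<m. B i \<in> power_products ?Y H) \<and>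
        word_val a x = (\<Sum>i<m. scale (\<alpha> i) (word_val a (power_product (B i))))"
      by (rule span_image_finite_sum) blast
  qed
  then have "has_height scale l a ?Y (LEAST h. height_bound scale l a ?Y h)"
    and "(LEAST h. height_bound scale l a ?Y h) \<le> H"
    unfolding has_height_def by (auto intro: LeastI Least_le)
  then show ?thesis
    using m(2) unfolding H_def[symmetric] by (meson of_nat_mono order_trans)
qed

end
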